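(* Let $m,k\in\mathbb Z^+$, $a_1,\ldots,a_k\in\mathbb Z$, $n_1,\ldots,n_k\in\mathbb Z^+$. Then the system $\{a_s(n_s)\}_{s=1}^k$ is an $m$-system (i.e. every $x\in\mathbb Z$ satisfies $|\{1\leqslant s\leqslant k: x\equiv a_s\pmod{n_s}\}|\leqslant m$) if and only if $$\sum_{\substack{x_s\in[0,n_s)\text{ for }s\in[1,k]\\ \{\sum_{s=1}^kx_s/n_s\}=\theta}}\binom{\lfloor\sum_{s=1}^kx_s/n_s\rfloor}{n}e^{2\pi i\sum_{s=1}^ka_sx_s/n_s}=0$$ for all real $0\leqslant\theta<1$ and all integers $n$ with $0\leqslant n<k-m$.
   Context: $[0,n_s)=\{0,1,\ldots,n_s-1\}$, $[1,k]=\{1,\ldots,k\}$; $\{x\}$ and $\lfloor x\rfloor$ denote fractional and integer parts; $\binom{j}{n}=0$ when $0\leqslant j<n$. *)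

theory Defs
  imports Complex_Main "HOL-Library.FuncSet" "HOL-Number_Theory.Cong"
begin

definition m_system :: "nat \<Rightarrow> nat \<Rightarrow> (nat \<Rightarrow> int) \<Rightarrow> (nat \<Rightarrow> nat) \<Rightarrow> bool" where
  "m_system m k a n \<longleftrightarrow>
     (\<forall>x::int. card {s \<in> {1..k}. [x = a s] (mod int (n s))} \<le> m)"

end

theory Submission
  imports Defs "HOL-Computational_Algebra.Fundamental_Theorem_Algebra"
    "HOL-Analysis.Complex_Transcendental"
begin

text \<open>
  Put \<open>N = n\<^sub>1 \<cdots> n\<^sub>k\<close>, \<open>\<omega>\<^sub>s = exp (2 \<pi> i a\<^sub>s / n\<^sub>s)\<close> and \<open>W = z\<^sup>N - 1\<close>, and consider the polynomial \<open>F\<close>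
  that is the product over \<open>s\<close> of the geometric sums
  \<open>\<Sum>v<n\<^sub>s. (\<omega>\<^sub>s z\<^bsup>N/n\<^sub>s\<^esup>)\<^bsup>v\<^esup> = W / (\<omega>\<^sub>s z\<^bsup>N/n\<^sub>s\<^esup> - 1)\<close>.  At the \<open>N\<close>-th root of unity
  \<open>exp (-2 \<pi> i x / N)\<close> it vanishes to order exactly \<open>k\<close> minus the number of \<open>s\<close> with
  \<open>x \<equiv> a\<^sub>s (mod n\<^sub>s)\<close>, so the system is an \<open>m\<close>-system iff \<open>W\<^bsup>k-m\<^esup>\<close> divides \<open>F\<close>.
  Expanding \<open>F\<close> into monomials and writing \<open>z\<^bsup>Nf+j\<^esup> = (\<Sum>r. (f choose r) W\<^bsup>r\<^esup>) z\<^bsup>j\<^esup>\<close> with \<open>j < N\<close> gives the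
  \<open>W\<close>-adic expansion of \<open>F\<close>.  The coefficient of \<open>W\<^bsup>r\<^esup> z\<^bsup>j\<^esup>\<close> in it is the sum of the theorem for
  \<open>\<theta> = j/N\<close>, and divisibility by \<open>W\<^bsup>k-m\<^esup>\<close> means that the digits with \<open>r < k - m\<close> vanish.
\<close>

section \<open>Divisibility by powers of \<open>W\<close> and digits in base
  \<open>W\<close>\<close>

text \<open>Digits in base \<open>W\<close> are unique: once the digits below \<open>r\<close>
  vanish, only \<open>W ^ r * B r\<close> survives modulo \<open>W ^ Suc r\<close>. Cancelling
  \<open>W ^ r\<close> shows that \<open>W\<close> divides \<open>B r\<close>, and the degree bound
  forces \<open>B r = 0\<close>.\<close>

lemma power_dvd_adic_expansion_iff:
  fixes W :: "'a::field poly"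
  assumes deg: "\<And>r. degree (B r) < degree W" and "d \<le> R"
  shows "W ^ d dvd (\<Sum>r<R. W ^ r * B r) \<longleftrightarrow> (\<forall>r<d. B r = 0)"
proof
  assume dvd: "W ^ d dvd (\<Sum>r<R. W ^ r * B r)"
  have "W \<noteq> 0" using deg[of 0] by auto
  have "r < d \<longrightarrow> B r = 0" for r
  proof (induction r rule: less_induct)
    case (less r)
    show ?case
    proof
      assume r: "r < d"
      have split: "{..<R} = {..<r} \<union> insert r {r<..<R}" using r \<open>d \<le> R\<close> by auto
      have "(\<Sum>i<r. W ^ i * B i) = 0" using less r by (intro sum.neutral) auto
      then have eq: "(\<Sum>i<R. W ^ i * B i) = W ^ r * B r + (\<Sum>i\<in>{r<..<R}. W ^ i * B i)"
        unfolding split by (subst sum.union_disjoint) auto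
      have "W ^ Suc r dvd (\<Sum>i<R. W ^ i * B i)"
        using r by (intro dvd_trans[OF le_imp_power_dvd dvd]) auto
      moreover have "W ^ Suc r dvd (\<Sum>i\<in>{r<..<R}. W ^ i * B i)"
        by (intro dvd_sum dvd_mult2 le_imp_power_dvd) auto
      ultimately have "W ^ Suc r dvd W ^ r * B r"
        unfolding eq by (simp only: dvd_add_left_iff)
      then have "W dvd B r"
        using \<open>W \<noteq> 0\<close> by (simp add: mult.commute[of W])
      then show "B r = 0" using deg[of r] dvd_imp_degree_le by force
    qed
  qed
  then show "\<forall>r<d. B r = 0" by blast
next
  assume "\<forall>r<d. B r = 0"
  then have "W ^ d dvd W ^ r * B r" for r
    by (cases "r < d") (auto intro!: dvd_mult2 le_imp_power_dvd)
  then show "W ^ d dvd (\<Sum>r<R. W ^ r * B r)" by (intro dvd_sum)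
qed

lemma degree_monom_minus_1:
  assumes "M > 0" "c \<noteq> (0::'a::field)"
  shows "degree (monom c M - 1) = M"
proof -
  have "degree (- 1 + monom c M) = degree (monom c M)"
    using assms by (intro degree_add_eq_right) (auto simp: degree_monom_eq)
  then show ?thesis using assms by (simp add: degree_monom_eq)
qed

text \<open>The sum on the right is the coefficient of degree \<open>j\<close> in the
  \<open>r\<close>-th digit. It arises from the binomial expansion of \<open>(W + 1) ^ f\<close>,
  where \<open>f = e x div N\<close> and \<open>W + 1\<close> is the monomial of degree
  \<open>N\<close>.\<close>

lemma power_dvd_sum_monom_iff:
  fixes c :: "'b \<Rightarrow> 'a::field" and e :: "'b \<Rightarrow> nat"
  assumes "finite A" "N > 0"
  shows "(monom 1 N - 1) ^ d dvd (\<Sum>x\<in>A. monom (c x) (e x)) \<longleftrightarrow>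
    (\<forall>r<d. \<forall>j<N. (\<Sum>x\<in>{x\<in>A. e x mod N = j}. of_nat (e x div N choose r) * c x) = 0)"
proof -
  define W :: "'a poly" where "W = monom 1 N - 1"
  define B where "B = (\<lambda>r. \<Sum>x\<in>A. monom (of_nat (e x div N choose r) * c x) (e x mod N))"
  \<comment> \<open>One range of digits for all \<open>x\<close>: \<open>R\<close> exceeds every
    quotient \<open>e x div N\<close> and is at least \<open>d\<close>, as the digit criterion
    demands.\<close>
  define R where "R = d + Suc (\<Sum>x\<in>A. e x)"
  have R: "e x div N < R" if "x \<in> A" for x
  proof -
    have "e x \<le> (\<Sum>x\<in>A. e x)" using that assms by (intro member_le_sum) auto
    then show ?thesis using div_le_dividend[of "e x" N] unfolding R_def by linarith
  qed
  have degW: "degree W = N" unfolding W_def using assms by (simp add: degree_monom_minus_1)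
  have coeffB: "coeff (B r) j =
      (\<Sum>x\<in>{x\<in>A. e x mod N = j}. of_nat (e x div N choose r) * c x)" for r j
    using assms by (simp add: B_def coeff_sum sum.inter_filter)
  have coeffB0: "coeff (B r) j = 0" if "j \<ge> N" for r j
  proof -
    have "{x\<in>A. e x mod N = j} = {}" using that mod_less_divisor[OF assms(2)] not_le by blast
    then show ?thesis unfolding coeffB by (simp only: sum.empty)
  qed
  \<comment> \<open>If the degree were at least \<open>N\<close>, the leading coefficient would
    vanish, so \<open>B r = 0\<close>, whose degree 0 is below \<open>N\<close>.\<close>
  have degB: "degree (B r) < degree W" for r
    unfolding degW using assms(2) coeffB0
    by (metis leading_coeff_0_iff degree_0 not_le)
  have expand: "monom (c x) (e x) =
      (\<Sum>r<R. W ^ r * monom (of_nat (e x div N choose r) * c x) (e x mod N))" if "x \<in> A" for x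
  proof -
    have "monom (c x) (e x) = monom (c x) (e x mod N) * (W + 1) ^ (e x div N)"
      by (simp add: W_def monom_power mult_monom)
    also have "(W + 1) ^ (e x div N) = (\<Sum>r\<le>e x div N. of_nat (e x div N choose r) * W ^ r)"
      by (simp add: binomial_ring)
    also have "\<dots> = (\<Sum>r<R. of_nat (e x div N choose r) * W ^ r)"
      using R[OF that] by (intro sum.mono_neutral_left) (auto simp: not_le binomial_eq_0)
    finally have "monom (c x) (e x) =
        (\<Sum>r<R. monom (c x) (e x mod N) * (of_nat (e x div N choose r) * W ^ r))"
      by (simp only: sum_distrib_left)
    moreover have "W ^ r * monom (of_nat b * c x) j = monom (c x) j * (of_nat b * W ^ r)" for b j r
      by (simp add: of_nat_poly mult.commute[of _ "W ^ r"] flip: smult_monom)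
    ultimately show ?thesis by (simp only:)
  qed
  have "(\<Sum>x\<in>A. monom (c x) (e x)) = (\<Sum>r<R. W ^ r * B r)"
    unfolding B_def sum_distrib_left by (subst sum.swap) (simp add: expand)
  then have "W ^ d dvd (\<Sum>x\<in>A. monom (c x) (e x)) \<longleftrightarrow> (\<forall>r<d. B r = 0)"
    using power_dvd_adic_expansion_iff[of B W d R] degB by (simp add: R_def)
  also have "\<dots> \<longleftrightarrow> (\<forall>r<d. \<forall>j<N. coeff (B r) j = 0)"
    using coeffB0 by (auto simp: poly_eq_iff) (metis not_le)
  finally show ?thesis unfolding W_def coeffB .
qed

section \<open>Divisibility through orders of vanishing\<close>

lemma order_prod:
  fixes p :: "'b \<Rightarrow> 'a::idom poly"
  assumes "finite A" "\<And>x. x \<in> A \<Longrightarrow> p x \<noteq> 0"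
  shows "order a (\<Prod>x\<in>A. p x) = (\<Sum>x\<in>A. order a (p x))"
  using assms by (induction A rule: finite_induct) (auto simp: order_mult)

text \<open>A root of \<open>p\<close> is also a root of \<open>q\<close>. Removing the common
  linear factor lowers both orders alike, so induction on the degree of \<open>p\<close> applies
  until \<open>p\<close> is a unit.\<close>

lemma order_le_imp_dvd:
  fixes p q :: "'a::alg_closed_field poly"
  assumes "p \<noteq> 0" "q \<noteq> 0" "\<And>a. order a p \<le> order a q"
  shows "p dvd q"
  using assms
proof (induction "degree p" arbitrary: p q rule: less_induct)
  case less
  show ?case
  proof (cases "degree p = 0")
    case True
    then show ?thesis using less.prems(1) is_unit_iff_degree unit_imp_dvd by blast
  next
    case False
    then obtain x where x: "poly p x = 0" using alg_closed_imp_poly_has_root by blast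
    then have "poly q x = 0" using less.prems by (metis le_zero_eq order_root)
    with x obtain p' q' where pq: "p = [:-x, 1:] * p'" "q = [:-x, 1:] * q'"
      by (metis poly_eq_0_iff_dvd dvdE)
    then have nz: "p' \<noteq> 0" "q' \<noteq> 0" using less.prems by auto
    have "degree p = Suc (degree p')" using nz by (simp add: pq degree_mult_eq del: mult_pCons_left)
    moreover have "order a p' \<le> order a q'" for a
      using less.prems(3)[of a] less.prems(1,2) unfolding pq by (simp add: order_mult del: mult_pCons_left)
    ultimately have "p' dvd q'" using less.hyps nz by simp
    then show ?thesis unfolding pq by (intro mult_dvd_mono) auto
  qed
qed

text \<open>All roots are simple: in characteristic 0 the derivative can vanish only at 0, where the
  polynomial itself is -1.\<close>

lemma order_monom_minus_1:
  fixes c :: "'a::field_char_0"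
  assumes "M > 0" "c \<noteq> 0"
  shows "order z (monom c M - 1) = (if c * z ^ M = 1 then 1 else 0)"
proof -
  let ?p = "monom c M - 1"
  have nz: "?p \<noteq> 0" using assms degree_monom_minus_1[of M c] by auto
  have "poly (pderiv ?p) a \<noteq> 0" if "poly ?p a = 0" for a
    using that assms by (auto simp: pderiv_diff pderiv_monom poly_monom power_0_left)
  then have "rsquarefree ?p" unfolding rsquarefree_roots by auto
  then have "order z ?p = 0 \<or> order z ?p = 1" unfolding rsquarefree_def by auto
  moreover have "order z ?p \<noteq> 0 \<longleftrightarrow> c * z ^ M = 1"
    using order_root[of ?p z] nz by (simp add: poly_monom)
  ultimately show ?thesis by auto
qed

text \<open>The \<open>d\<close>-th power of \<open>?W\<close> has order \<open>d\<close> at each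
  \<open>N\<close>-th root of unity and order 0 elsewhere, so divisibility is a comparison of
  orders.\<close>

lemma monom_minus_1_power_dvd_iff:
  fixes p :: "'a::{alg_closed_field, field_char_0} poly"
  assumes "N > 0" "p \<noteq> 0"
  shows "(monom 1 N - 1) ^ d dvd p \<longleftrightarrow> (\<forall>z. z ^ N = 1 \<longrightarrow> d \<le> order z p)"
proof -
  let ?W = "monom 1 N - 1 :: 'a poly"
  have nz: "?W \<noteq> 0" using assms degree_monom_minus_1[of N "1::'a"] by auto
  have ord: "order z (?W ^ d) = (if z ^ N = 1 then d else 0)" for z
    using order_prod[of "{..<d}" "\<lambda>_. ?W" z] nz order_monom_minus_1[of N 1 z] assms by simp
  show ?thesis
    using dvd_imp_order_le[of p "?W ^ d"] order_le_imp_dvd[of "?W ^ d" p] nz assms ord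
    by (metis power_not_zero zero_le)
qed

text \<open>Telescoping each geometric sum turns \<open>?G * F\<close> into a power of
  \<open>?W\<close>, of order \<open>card S\<close> at \<open>z\<close>. The factor
  \<open>?G\<close> accounts for one unit for each \<open>s\<close> with
  \<open>\<omega> s * z ^ M s = 1\<close>; the rest belongs to \<open>F\<close>.\<close>

lemma order_prod_geometric:
  fixes \<omega> :: "'b \<Rightarrow> 'a::field_char_0" and M n :: "'b \<Rightarrow> nat"
  assumes "finite S" "N > 0" "\<And>s. s \<in> S \<Longrightarrow> M s * n s = N" "\<And>s. s \<in> S \<Longrightarrow> \<omega> s ^ n s = 1"
  defines "F \<equiv> \<Prod>s\<in>S. \<Sum>v<n s. monom (\<omega> s) (M s) ^ v"
  shows "F \<noteq> 0"
    and "z ^ N = 1 \<Longrightarrow> order z F + card {s\<in>S. \<omega> s * z ^ M s = 1} = card S"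
proof -
  let ?W = "monom 1 N - 1 :: 'a poly"
  let ?G = "\<Prod>s\<in>S. monom (\<omega> s) (M s) - 1"
  have M: "M s > 0" if "s \<in> S" for s using assms(2,3) that by (metis mult_eq_0_iff not_gr0)
  have n: "n s > 0" if "s \<in> S" for s using assms(2,3) that by (metis mult_eq_0_iff not_gr0)
  have \<omega>: "\<omega> s \<noteq> 0" if "s \<in> S" for s using assms(4) n that by (metis power_0_left less_irrefl zero_neq_one)
  have W: "?W \<noteq> 0" using assms(2) degree_monom_minus_1[of N "1::'a"] by auto
  have factor: "(monom (\<omega> s) (M s) - 1) * (\<Sum>v<n s. monom (\<omega> s) (M s) ^ v) = ?W" if "s \<in> S" for s
    using power_diff_1_eq[of "monom (\<omega> s) (M s)" "n s"] assms(3,4) that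
    by (simp add: monom_power)
  have "?G * F = (\<Prod>s\<in>S. ?W)"
    unfolding F_def prod.distrib[symmetric] by (intro prod.cong factor refl)
  then have GF: "?G * F \<noteq> 0" "?G * F = (\<Prod>s\<in>S. ?W)" using W by auto
  then show "F \<noteq> 0" by auto
  show "order z F + card {s\<in>S. \<omega> s * z ^ M s = 1} = card S" if "z ^ N = 1"
  proof -
    have "order z ?G = (\<Sum>s\<in>S. if \<omega> s * z ^ M s = 1 then 1 else 0)"
      using GF(1) assms(1) M \<omega> by (subst order_prod) (auto simp: order_monom_minus_1)
    also have "\<dots> = card {s\<in>S. \<omega> s * z ^ M s = 1}"
      using assms(1) by (simp flip: sum.inter_filter)
    finally have G: "order z ?G = \<dots>" .
    have "order z (?G * F) = (\<Sum>s\<in>S. order z ?W)"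
      unfolding GF(2) using W assms(1) by (intro order_prod) auto
    also have "\<dots> = card S" using that assms(2) by (simp add: order_monom_minus_1)
    finally show ?thesis using order_mult[OF GF(1), of z] G by simp
  qed
qed

section \<open>Congruences as conditions on roots of unity\<close>

lemma prod_monom: "(\<Prod>s\<in>S. monom (c s) (e s)) = monom (\<Prod>s\<in>S. c s) (\<Sum>s\<in>S. e s)"
  by (induction S rule: infinite_finite_induct) (auto simp: mult_monom)

lemma exp_two_pi_i_div_eq_1_iff:
  assumes "n > 0"
  shows "exp (2 * complex_of_real pi * \<i> * of_int b / of_nat n) = 1 \<longleftrightarrow> int n dvd b"
proof -
  have "exp (2 * complex_of_real pi * \<i> * of_int b / of_nat n) = 1 \<longleftrightarrow>
      (\<exists>t::int. real_of_int b = real_of_int t * real n)"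
    using assms by (simp add: exp_eq_1 field_simps)
  also have "\<dots> \<longleftrightarrow> (\<exists>t::int. b = t * int n)"
    by (metis of_int_eq_iff of_int_mult of_int_of_nat_eq)
  finally show ?thesis by (auto simp: dvd_def mult.commute)
qed

lemma m_system_iff_roots_of_unity:
  fixes a :: "nat \<Rightarrow> int" and M n :: "nat \<Rightarrow> nat"
  assumes "N > 0" "\<And>s. s \<in> {1..k} \<Longrightarrow> M s * n s = N"
  defines "\<omega> \<equiv> \<lambda>s. exp (2 * complex_of_real pi * \<i> * of_int (a s) / of_nat (n s))"
  shows "m_system m k a n \<longleftrightarrow> (\<forall>z. z ^ N = 1 \<longrightarrow> card {s\<in>{1..k}. \<omega> s * z ^ M s = 1} \<le> m)"
proof -
  \<comment> \<open>The minus sign makes the product \<open>\<omega> s * \<zeta> x ^ M s\<close>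
    depend on \<open>a s - x\<close>, so that it equals 1 exactly when \<open>x\<close> lies in the
    \<open>s\<close>-th residue class.\<close>
  define \<zeta> where "\<zeta> = (\<lambda>x::int. exp (2 * complex_of_real pi * \<i> * of_int (- x) / of_nat N))"
  have n: "n s > 0" if "s \<in> {1..k}" for s using assms(1,2) that by (metis mult_eq_0_iff not_gr0)
  have root: "\<omega> s * \<zeta> x ^ M s = 1 \<longleftrightarrow> [x = a s] (mod int (n s))" if s: "s \<in> {1..k}" for s x
  proof -
    have "M s > 0" using assms(1,2) s by (metis mult_eq_0_iff not_gr0)
    moreover have "of_nat N = (of_nat (M s) * of_nat (n s) :: complex)"
      using assms(2)[OF s] by (metis of_nat_mult)
    ultimately have "\<omega> s * \<zeta> x ^ M s =
        exp (2 * complex_of_real pi * \<i> * of_int (a s - x) / of_nat (n s))"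
      using n[OF s]
      by (simp add: \<omega>_def \<zeta>_def field_simps flip: exp_of_nat_mult exp_add)
    then show ?thesis
      using exp_two_pi_i_div_eq_1_iff[OF n[OF s], of "a s - x"]
      by (simp add: cong_iff_dvd_diff dvd_diff_commute)
  qed
  have "{z. z ^ N = 1} = range \<zeta>"
  proof (intro equalityI subsetI)
    fix z :: complex assume "z \<in> {z. z ^ N = 1}"
    then obtain j where "z = exp (2 * of_real pi * \<i> * of_nat j / of_nat N)"
      using complex_roots_unity[of N] assms(1) by auto
    then have "z = \<zeta> (- int j)" by (simp add: \<zeta>_def)
    then show "z \<in> range \<zeta>" by blast
  next
    fix z assume "z \<in> range \<zeta>"
    then obtain x where "z = \<zeta> x" by blast
    \<comment> \<open>The denominator 1 gives the shape to which the criterion for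
      \<open>exp\<close> applies, with the trivial divisor 1.\<close>
    then have "z ^ N = exp (2 * complex_of_real pi * \<i> * of_int (- x) / of_nat 1)"
      using assms(1) by (simp add: \<zeta>_def flip: exp_of_nat_mult)
    then show "z \<in> {z. z ^ N = 1}"
      using exp_two_pi_i_div_eq_1_iff[of 1 "- x"] by simp
  qed
  then have "z ^ N = 1 \<longleftrightarrow> (\<exists>x. z = \<zeta> x)" for z by blast
  then have "(\<forall>z. z ^ N = 1 \<longrightarrow> card {s\<in>{1..k}. \<omega> s * z ^ M s = 1} \<le> m) \<longleftrightarrow>
      (\<forall>x. card {s\<in>{1..k}. \<omega> s * \<zeta> x ^ M s = 1} \<le> m)"
    by auto
  also have "\<dots> \<longleftrightarrow> m_system m k a n"
    unfolding m_system_def using root by (simp cong: conj_cong)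
  finally show ?thesis by simp
qed

section \<open>From divisibility to the exponential sums\<close>

theorem theorem3p1:
  fixes m k :: nat and a :: "nat \<Rightarrow> int" and n :: "nat \<Rightarrow> nat"
  assumes "m > 0" and "k > 0" and "\<And>s. s \<in> {1..k} \<Longrightarrow> n s > 0"
  shows "m_system m k a n \<longleftrightarrow>
    (\<forall>\<theta>::real. \<forall>r::nat. 0 \<le> \<theta> \<and> \<theta> < 1 \<and> int r < int k - int m \<longrightarrow>
      (\<Sum>x \<in> {x \<in> (\<Pi>\<^sub>E s\<in>{1..k}. {0..<n s}).
                 frac (\<Sum>s=1..k. real (x s) / real (n s)) = \<theta>}.
         of_nat (nat \<lfloor>\<Sum>s=1..k. real (x s) / real (n s)\<rfloor> choose r) *
         exp (2 * complex_of_real pi * \<i> *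
              (\<Sum>s=1..k. of_int (a s) * of_nat (x s) / of_nat (n s)))) = 0)"
proof -
  define N where "N = (\<Prod>s\<in>{1..k}. n s)"
  define M where "M = (\<lambda>s. N div n s)"
  define \<omega> where "\<omega> = (\<lambda>s. exp (2 * complex_of_real pi * \<i> * of_int (a s) / of_nat (n s)))"
  define A where "A = (\<Pi>\<^sub>E s\<in>{1..k}. {0..<n s})"
  define e where "e = (\<lambda>x. \<Sum>s=1..k. M s * x s)"
  define c where "c = (\<lambda>x. \<Prod>s=1..k. \<omega> s ^ x s)"
  define F where "F = (\<Prod>s\<in>{1..k}. \<Sum>v<n s. monom (\<omega> s) (M s) ^ v)"
  have N: "N > 0" unfolding N_def using assms(3) by (intro prod_pos) auto
  have MN: "M s * n s = N" if "s \<in> {1..k}" for s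
    using that unfolding M_def N_def by (simp add: dvd_prodI)
  have \<omega>: "\<omega> s ^ n s = 1" if "s \<in> {1..k}" for s
    using assms(3)[OF that] exp_two_pi_i_div_eq_1_iff[of 1 "a s"]
    by (simp add: \<omega>_def flip: exp_of_nat_mult)
  have finA: "finite A" unfolding A_def by (intro finite_PiE) auto

  \<comment> \<open>Multiplying out picks one exponent \<open>x s\<close> from each geometric sum,
    so the terms are indexed by the tuples in \<open>A\<close>.\<close>
  have F_eq: "F = (\<Sum>x\<in>A. monom (c x) (e x))"
    unfolding F_def A_def c_def e_def
    by (subst prod_sum_PiE) (auto simp: lessThan_atLeast0 monom_power prod_monom)
  have "m_system m k a n \<longleftrightarrow> (\<forall>z. z ^ N = 1 \<longrightarrow> card {s\<in>{1..k}. \<omega> s * z ^ M s = 1} \<le> m)"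
    unfolding \<omega>_def using N MN by (intro m_system_iff_roots_of_unity) auto
  also have "\<dots> \<longleftrightarrow> (\<forall>z. z ^ N = 1 \<longrightarrow> k - m \<le> order z F)"
  proof (intro all_cong1 imp_cong refl)
    fix z :: complex assume "z ^ N = 1"
    then have "order z F + card {s\<in>{1..k}. \<omega> s * z ^ M s = 1} = k"
      using order_prod_geometric(2)[of "{1..k}" N M n \<omega> z] N MN \<omega> by (simp add: F_def)
    \<comment> \<open>For \<open>m \<ge> k\<close> the truncated difference \<open>k - m\<close> is
      0 and both sides hold.\<close>
    then show "card {s\<in>{1..k}. \<omega> s * z ^ M s = 1} \<le> m \<longleftrightarrow> k - m \<le> order z F" by linarith
  qed
  also have "\<dots> \<longleftrightarrow> (monom 1 N - 1) ^ (k - m) dvd F"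
    using order_prod_geometric(1)[of "{1..k}" N M n \<omega>] N MN \<omega>
    by (subst monom_minus_1_power_dvd_iff) (auto simp: F_def)
  also have "\<dots> \<longleftrightarrow>
    (\<forall>r<k - m. \<forall>j<N. (\<Sum>x\<in>{x\<in>A. e x mod N = j}. of_nat (e x div N choose r) * c x) = 0)"
    unfolding F_eq by (rule power_dvd_sum_monom_iff[OF finA N])
  also have "\<dots> \<longleftrightarrow> (\<forall>\<theta>::real. \<forall>r::nat. 0 \<le> \<theta> \<and> \<theta> < 1 \<and> int r < int k - int m \<longrightarrow>
      (\<Sum>x\<in>{x\<in>A. real (e x mod N) / real N = \<theta>}. of_nat (e x div N choose r) * c x) = 0)"
    (is "?L \<longleftrightarrow> ?R")
  proof
    assume L: ?L
    show ?R
    proof (intro allI impI)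
      fix \<theta> :: real and r :: nat
      assume h: "0 \<le> \<theta> \<and> \<theta> < 1 \<and> int r < int k - int m"
      show "(\<Sum>x\<in>{x\<in>A. real (e x mod N) / real N = \<theta>}. of_nat (e x div N choose r) * c x) = 0"
      proof (cases "\<exists>j<N. \<theta> = real j / real N")
        case True
        then obtain j where "j < N" "\<theta> = real j / real N" by blast
        then show ?thesis using L h N by simp
      next
        case False
        \<comment> \<open>Fractional parts occur only as \<open>j / N\<close> with
          \<open>j < N\<close>; every other \<open>\<theta>\<close> gives an empty sum.\<close>
        then have "{x\<in>A. real (e x mod N) / real N = \<theta>} = {}"
          using N mod_less_divisor by blast
        then show ?thesis by (simp only: sum.empty)
      qed
    qed
  next
    assume R: ?R
    show ?L
    proof (intro allI impI)
      fix r j assume "r < k - m" "j < N"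
      then show "(\<Sum>x\<in>{x\<in>A. e x mod N = j}. of_nat (e x div N choose r) * c x) = 0"
        using R[rule_format, of "real j / real N" r] N by simp
    qed
  qed
  finally have main: "m_system m k a n \<longleftrightarrow> ?R" .

  \<comment> \<open>Over the common denominator \<open>N\<close> the numerator is the exponent
    \<open>e x\<close>; integer and fractional parts thus become quotient and remainder modulo
    \<open>N\<close>.\<close>
  have sum_eq: "(\<Sum>s=1..k. real (x s) / real (n s)) = real (e x) / real N" for x
  proof -
    have "real (x s) / real (n s) = real (M s * x s) / real N" if "s \<in> {1..k}" for s
    proof -
      have "M s > 0" using MN[OF that] N by (metis mult_eq_0_iff not_gr0)
      then show ?thesis unfolding MN[OF that, symmetric] using assms(3)[OF that]
        by (simp add: field_simps)
    qed
    then show ?thesis unfolding e_def by (simp add: sum_divide_distrib)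
  qed
  have floor_eq: "\<lfloor>\<Sum>s=1..k. real (x s) / real (n s)\<rfloor> = int (e x div N)" for x
    unfolding sum_eq by (simp add: floor_divide_of_nat_eq)
  have frac_eq: "frac (\<Sum>s=1..k. real (x s) / real (n s)) = real (e x mod N) / real N" for x
  proof -
    have "real (e x) = real (e x div N) * real N + real (e x mod N)"
      by (simp flip: of_nat_mult of_nat_add)
    then show ?thesis unfolding frac_def floor_eq unfolding sum_eq using N
      by (simp add: field_simps)
  qed
  have exp_eq: "exp (2 * complex_of_real pi * \<i> *
      (\<Sum>s=1..k. of_int (a s) * of_nat (x s) / of_nat (n s))) = c x" for x
    unfolding c_def \<omega>_def
    by (simp add: sum_distrib_left exp_sum mult_ac flip: exp_of_nat_mult)
  show ?thesis
    unfolding floor_eq frac_eq exp_eq nat_int A_def[symmetric] by (rule main)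
qed

end
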